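(* Let $T: X \rightarrow X$ be an operator (i.e. a continuous linear map) on a separable F-space $X$. Suppose that there are dense subsets $X_0, Y_0$ of $X$ and mappings $S_n:Y_0\rightarrow X$, $n\geq 0$, with the following property: for any $y\in Y_0$ and $\varepsilon>0$ there exist $A\subset\mathbb{N}_0$ with $\overline{\mathrm{dens}}\,A>0$ and $\delta>0$ such that (i) for any $x\in X_0$ there is some $B\subset A$ with $\overline{\mathrm{dens}}\,B>\delta$ such that, for any $n\in B$, $\|T^nx\|<\varepsilon$; (ii) $\sum _{n\in A} S_n y$ converges; (iii) for any $m\in A$, $\big\|T^m \sum _{n\in A} S_n y-y\big\| <\varepsilon$. Then $T$ is upper frequently hypercyclic.
   Context: Let $\mathbb{N}_0=\{0,1,2,\ldots\}$. For $A\subset\mathbb{N}_0$ the upper density is $\overline{\mathrm{dens}}\, A = \limsup_{N\to\infty} \frac{1}{N+1}\mathrm{card} (A \cap [0,N])$. $T$ is called upper frequently hypercyclic if there exists $x\in X$ such that, for any non-empty open set $U$ in $X$, $\overline{\mathrm{dens}}\,\{n\geq 0 : T^nx\in U\}>0$. The topology of a metrizable topological vector space (over $\mathbb{R}$ or $\mathbb{C}$) may be defined by an F-norm, that is, a function $\|\cdot\|\ge 0$ with $\|x+y\|\leq\|x\|+\|y\|$, $\|\lambda x\|\leq\|x\|$ for $|\lambda|\leq 1$, $\lim_{\lambda\to 0}\|\lambda x\|=0$, and $\|x\|=0$ only if $x=0$. The symbol $\|\cdot\|$ denotes a fixed F-norm defining the topology of $X$. An F-space is a metrizable topological vector space that is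 complete under some (equivalently any) F-norm defining its topology. Sums over subsets of $\mathbb{N}_0$ are taken in increasing order of the index. *)

theory Defs
  imports "HOL-Analysis.Analysis"
begin

text \<open>
  Scalars range over a type \<open>'k\<close> of class \<^class>\<open>real_normed_field\<close>. By the Gelfand--Mazur
  theorem and multiplicativity of the norm, the instances of this class are, up to isometric
  isomorphism, exactly the real and the complex numbers. The class
  \<^class>\<open>topological_ab_group_add\<close> supplies the topology of a vector space and the continuity
  of its addition.
\<close>

definition upper_density :: "nat set \<Rightarrow> ereal" where
  "upper_density A = limsup (\<lambda>N. ereal (real (card (A \<inter> {0..N})) / (real N + 1)))"

definition F_norm :: "('k::real_normed_field \<Rightarrow> 'x::ab_group_add \<Rightarrow> 'x) \<Rightarrow> ('x \<Rightarrow> real) \<Rightarrow> bool" where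
  "F_norm sm N \<longleftrightarrow>
     (\<forall>x. 0 \<le> N x) \<and>
     (\<forall>x y. N (x + y) \<le> N x + N y) \<and>
     (\<forall>c x. norm c \<le> 1 \<longrightarrow> N (sm c x) \<le> N x) \<and>
     (\<forall>x. ((\<lambda>c. N (sm c x)) \<longlongrightarrow> 0) (at 0)) \<and>
     (\<forall>x. N x = 0 \<longrightarrow> x = 0)"

text \<open>The metric of an F-norm; hence the notions of \<^locale>\<open>Metric_space\<close> apply to it.\<close>

lemma F_norm_Metric_space:
  fixes sm :: "'k::real_normed_field \<Rightarrow> 'x::ab_group_add \<Rightarrow> 'x"
  assumes V: "vector_space sm" and N: "F_norm sm N"
  shows "Metric_space UNIV (\<lambda>x y. N (x - y))"
proof -
  interpret vector_space sm by (rule V)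
  have tri: "N (x + y) \<le> N x + N y" and nn: "0 \<le> N x" and zero: "N x = 0 \<Longrightarrow> x = 0"
    and sc: "norm c \<le> 1 \<Longrightarrow> N (sm c x) \<le> N x"
    and lim: "((\<lambda>c. N (sm c x)) \<longlongrightarrow> 0) (at 0)" for x y c
    using N unfolding F_norm_def by auto
  have N0: "N 0 = 0"
    using lim[of 0] by (simp add: tendsto_const_iff)
  have minus_le: "N (- x) \<le> N x" for x
    using sc[of "- 1" x] by simp
  have minus: "N (- x) = N x" for x
    using minus_le[of x] minus_le[of "- x"] by simp
  show ?thesis
  proof
    show "N (x - y) = N (y - x)" for x y
      using minus[of "x - y"] by simp
    show "(N (x - y) = 0) = (x = y)" for x y
      using zero[of "x - y"] N0 by auto
    show "N (x - z) \<le> N (x - y) + N (y - z)" for x y z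
      using tri[of "x - y" "y - z"] by simp
  qed (rule nn)
qed

definition F_norm_defines_topology ::
  "('k::real_normed_field \<Rightarrow> 'x::topological_ab_group_add \<Rightarrow> 'x) \<Rightarrow> ('x \<Rightarrow> real) \<Rightarrow> bool" where
  "F_norm_defines_topology sm N \<longleftrightarrow>
     F_norm sm N \<and> Metric_space.mtopology UNIV (\<lambda>x y. N (x - y)) = euclidean"

definition topological_vector_space ::
  "('k::real_normed_field \<Rightarrow> 'x::topological_ab_group_add \<Rightarrow> 'x) \<Rightarrow> bool" where
  "topological_vector_space sm \<longleftrightarrow>
     vector_space sm \<and> continuous_on UNIV (\<lambda>(c, x). sm c x)"

definition F_space ::
  "('k::real_normed_field \<Rightarrow> 'x::topological_ab_group_add \<Rightarrow> 'x) \<Rightarrow> bool" where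
  "F_space sm \<longleftrightarrow>
     topological_vector_space sm \<and>
     metrizable_space (euclidean :: 'x topology) \<and>
     (\<exists>N. F_norm_defines_topology sm N \<and>
          Metric_space.mcomplete UNIV (\<lambda>x y. N (x - y)))"

definition upper_frequently_hypercyclic :: "('x::topological_space \<Rightarrow> 'x) \<Rightarrow> bool" where
  "upper_frequently_hypercyclic T \<longleftrightarrow>
     (\<exists>x. \<forall>U. open U \<and> U \<noteq> {} \<longrightarrow> upper_density {n. (T ^^ n) x \<in> U} > 0)"

text \<open>Extending a family by zero outside \<open>A\<close> turns its partial sums in increasing order
  of the index into ordinary partial sums over the natural numbers.\<close>

definition restrict_to :: "nat set \<Rightarrow> (nat \<Rightarrow> 'x::zero) \<Rightarrow> nat \<Rightarrow> 'x" where
  "restrict_to A f n = (if n \<in> A then f n else 0)"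

end

theory Submission
  imports Defs
begin

text \<open>
  The proof is a Baire category argument. In a Baire space with a countable base, \<open>T\<close> is upper
  frequently hypercyclic as soon as every non-empty open set \<open>V\<close> has a rate \<open>\<delta> > 0\<close> such that the
  points visiting \<open>V\<close> with upper density greater than \<open>\<delta>\<close> are dense (lemma
  \<open>upper_frequently_hypercyclic_if_uniform_rate\<close>). The reason is that "the proportion of visits up
  to some time \<open>N \<ge> m\<close> exceeds \<open>\<delta>\<close>" concerns only finitely many iterates, hence is an open
  condition; it is dense for each \<open>m\<close>, and a point that satisfies it for all \<open>m\<close> visits \<open>V\<close>
  with upper density at least \<open>\<delta>\<close>. Only countably many \<open>V\<close> need to be considered.

  For the rate to be uniform, \<open>\<delta>\<close> must be chosen before the place \<open>U\<close> where the point is sought, and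
  this is exactly what the hypotheses permit. Given \<open>V\<close>, choose \<open>y \<in> Y\<^sub>0 \<inter> V\<close> and \<open>\<epsilon>\<close> so small that
  the ball of radius \<open>2\<epsilon>\<close> around \<open>y\<close> lies in \<open>V\<close>; this fixes \<open>A\<close>, \<open>\<delta>\<close> and the sum
  \<open>z = (\<Sum>n\<in>A. S\<^sub>n y)\<close>. Given \<open>U\<close>, density of \<open>X\<^sub>0\<close> provides \<open>x \<in> X\<^sub>0\<close> with \<open>x + z \<in> U\<close>.
  For the times \<open>n\<close> in the corresponding set \<open>B \<subseteq> A\<close>, \<open>T\<^sup>n (x + z) - y\<close> is the sum of the small
  vectors \<open>T\<^sup>n x\<close> and \<open>T\<^sup>n z - y\<close>, so \<open>T\<^sup>n (x + z) \<in> V\<close>.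
\<close>

lemma (in Metric_space) separable_imp_second_countable:
  assumes "separable_space mtopology"
  shows "second_countable mtopology"
proof -
  obtain C where C: "countable C" "C \<subseteq> M" "mtopology closure_of C = M"
    using assms by (auto simp: separable_space_def)
  define \<B> where "\<B> = (\<lambda>(c, k::nat). mball c (inverse (Suc k))) ` (C \<times> UNIV)"
  have "\<exists>V\<in>\<B>. x \<in> V \<and> V \<subseteq> U" if U: "openin mtopology U" and x: "x \<in> U" for U x
  proof -
    have xM: "x \<in> M"
      using U x by (auto simp: openin_mtopology)
    obtain r where r: "r > 0" "mball x r \<subseteq> U"
      using U x by (auto simp: openin_mtopology)
    obtain k where k: "inverse (Suc k) < r / 2"
      using reals_Archimedean[of "r / 2"] r by auto
    have "x \<in> mtopology closure_of C"
      using C xM by simp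
    then obtain c where c: "c \<in> C" "d x c < inverse (Suc k)"
      unfolding metric_closure_of by (force dest: spec[of _ "inverse (Suc k)"])
    have "mball c (inverse (Suc k)) \<subseteq> mball x r"
      using triangle[of x c] c k C(2) xM by (force simp: subset_iff)
    moreover have "x \<in> mball c (inverse (Suc k))"
      using c C(2) xM by (auto simp: commute)
    ultimately show ?thesis
      using c(1) r(2) unfolding \<B>_def by force
  qed
  moreover have "countable \<B>"
    unfolding \<B>_def using C(1) by simp
  moreover have "openin mtopology V" if "V \<in> \<B>" for V
    using that by (auto simp: \<B>_def)
  ultimately show ?thesis
    unfolding second_countable_def by (intro exI[of _ \<B>]) auto
qed

lemma upper_density_mono:
  assumes "A \<subseteq> B"
  shows "upper_density A \<le> upper_density B"
  unfolding upper_density_def using assms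
  by (intro Limsup_mono always_eventually) (auto intro!: divide_right_mono card_mono)

lemma upper_density_greaterD:
  assumes "upper_density A > ereal \<delta>"
  shows "\<exists>N\<ge>m. real (card (A \<inter> {0..N})) / (real N + 1) > \<delta>"
proof (rule ccontr)
  assume "\<not> ?thesis"
  then have "\<forall>\<^sub>F N in sequentially. ereal (real (card (A \<inter> {0..N})) / (real N + 1)) \<le> ereal \<delta>"
    by (auto simp: eventually_sequentially not_less)
  then have "upper_density A \<le> ereal \<delta>"
    unfolding upper_density_def by (rule Limsup_bounded)
  with assms show False by simp
qed

lemma upper_density_geI:
  assumes "\<And>m. \<exists>N\<ge>m. real (card (A \<inter> {0..N})) / (real N + 1) > \<delta>"
  shows "upper_density A \<ge> ereal \<delta>"
proof (rule ccontr)
  assume "\<not> ?thesis"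
  then have "\<forall>\<^sub>F N in sequentially. ereal (real (card (A \<inter> {0..N})) / (real N + 1)) < ereal \<delta>"
    unfolding upper_density_def by (intro Limsup_lessD) auto
  then obtain m where "\<And>N. N \<ge> m \<Longrightarrow> real (card (A \<inter> {0..N})) / (real N + 1) < \<delta>"
    by (auto simp: eventually_sequentially)
  with assms[of m] show False by force
qed

lemma continuous_on_funpow:
  fixes T :: "'a::topological_space \<Rightarrow> 'a"
  assumes "continuous_on UNIV T"
  shows "continuous_on UNIV (T ^^ n)"
proof (induction n)
  case (Suc n)
  then show ?case
    using continuous_on_compose[OF Suc] continuous_on_subset[OF assms] by auto
qed (simp add: id_def)

text \<open>If \<open>x\<close> has more than a given number of visits up to time \<open>N\<close>, then so does every point that is
  at the times of these visits again in the open set \<open>V\<close>, and these points form a finite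
  intersection of open sets.\<close>

lemma open_visit_proportion_greater:
  fixes T :: "'a::topological_space \<Rightarrow> 'a"
  assumes T: "continuous_on UNIV T" and V: "open V"
  shows "open {x. real (card ({n. (T ^^ n) x \<in> V} \<inter> {0..N})) / (real N + 1) > \<delta>}"
proof (subst open_subopen, rule ballI)
  fix x
  let ?I = "\<lambda>x. {n. (T ^^ n) x \<in> V} \<inter> {0..N}"
  assume x: "x \<in> {x. real (card (?I x)) / (real N + 1) > \<delta>}"
  define W where "W = (\<Inter>n\<in>?I x. (T ^^ n) -` V)"
  have "open W"
    unfolding W_def by (intro open_INT ballI open_vimage V continuous_on_funpow T) simp
  moreover have "x \<in> W"
    by (auto simp: W_def)
  moreover have "real (card (?I w)) / (real N + 1) > \<delta>" if "w \<in> W" for w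
  proof -
    have "card (?I x) \<le> card (?I w)"
      using that by (intro card_mono) (auto simp: W_def)
    then have "real (card (?I x)) / (real N + 1) \<le> real (card (?I w)) / (real N + 1)"
      by (intro divide_right_mono) auto
    with x show ?thesis by simp
  qed
  ultimately show "\<exists>W. open W \<and> x \<in> W \<and> W \<subseteq> {x. real (card (?I x)) / (real N + 1) > \<delta>}"
    by blast
qed

text \<open>The Baire category criterion. It matters that \<open>\<delta>\<close> depends on \<open>V\<close> alone: with a rate that
  depended also on \<open>U\<close>, the dense open sets could not be formed.\<close>

lemma upper_frequently_hypercyclic_if_uniform_rate:
  fixes T :: "'a::topological_space \<Rightarrow> 'a"
  assumes complete: "completely_metrizable_space (euclidean :: 'a topology)"
    and countable_base: "second_countable (euclidean :: 'a topology)"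
    and T: "continuous_on UNIV T"
    and rate: "\<And>V. open V \<Longrightarrow> V \<noteq> {} \<Longrightarrow>
      \<exists>\<delta>>0. \<forall>U. open U \<and> U \<noteq> {} \<longrightarrow>
        (\<exists>x\<in>U. upper_density {n. (T ^^ n) x \<in> V} > ereal \<delta>)"
  shows "upper_frequently_hypercyclic T"
proof -
  obtain \<B> :: "'a set set" where \<B>: "countable \<B>" "\<And>V. V \<in> \<B> \<Longrightarrow> open V"
    and base: "\<And>U x. open U \<Longrightarrow> x \<in> U \<Longrightarrow> \<exists>V\<in>\<B>. x \<in> V \<and> V \<subseteq> U"
    using countable_base unfolding second_countable_def open_openin[symmetric] by metis
  obtain \<delta> where \<delta>_pos: "\<And>V. V \<in> \<B> - {{}} \<Longrightarrow> \<delta> V > 0"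
    and \<delta>: "\<And>V U. V \<in> \<B> - {{}} \<Longrightarrow> open U \<Longrightarrow> U \<noteq> {} \<Longrightarrow>
        \<exists>x\<in>U. upper_density {n. (T ^^ n) x \<in> V} > ereal (\<delta> V)"
  proof -
    have "\<forall>V\<in>\<B> - {{}}. \<exists>\<delta>>0. \<forall>U. open U \<and> U \<noteq> {} \<longrightarrow>
        (\<exists>x\<in>U. upper_density {n. (T ^^ n) x \<in> V} > ereal \<delta>)"
      using rate \<B>(2) by blast
    from bchoice[OF this] show ?thesis
      using that by blast
  qed
  define G where "G V m =
    (\<Union>N\<in>{m..}. {x. real (card ({n. (T ^^ n) x \<in> V} \<inter> {0..N})) / (real N + 1) > \<delta> V})" for V m
  let ?\<G> = "(\<lambda>(V, m). G V m) ` ((\<B> - {{}}) \<times> UNIV)"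
  have "euclidean closure_of \<Inter>?\<G> = topspace (euclidean :: 'a topology)"
  proof (rule Baire_category)
    fix W assume "W \<in> ?\<G>"
    then obtain V m where V: "V \<in> \<B> - {{}}" and W: "W = G V m"
      by auto
    have "open (G V m)"
      unfolding G_def using V \<B>(2) by (auto intro!: open_UN open_visit_proportion_greater T)
    moreover have "G V m \<inter> U \<noteq> {}" if U: "open U" "U \<noteq> {}" for U
    proof -
      obtain x where x: "x \<in> U" "upper_density {n. (T ^^ n) x \<in> V} > ereal (\<delta> V)"
        using \<delta>[OF V U] by blast
      have "x \<in> G V m"
        using upper_density_greaterD[OF x(2), of m] by (auto simp: G_def)
      with x(1) show ?thesis by blast
    qed
    ultimately show "openin euclidean W \<and> euclidean closure_of W = topspace euclidean"
      unfolding W dense_intersects_open open_openin[symmetric] by blast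
  qed (use complete \<B>(1) in auto)
  then have "\<Inter>?\<G> \<noteq> {}"
    by auto
  then obtain x where x: "\<And>V m. V \<in> \<B> - {{}} \<Longrightarrow> x \<in> G V m"
    by fastforce
  show ?thesis
    unfolding upper_frequently_hypercyclic_def
  proof (intro exI[of _ x] allI impI, elim conjE)
    fix U :: "'a set" assume "open U" "U \<noteq> {}"
    then obtain V where V: "V \<in> \<B> - {{}}" "V \<subseteq> U"
      using base by blast
    have "0 < ereal (\<delta> V)"
      using \<delta>_pos[OF V(1)] by simp
    also have "\<dots> \<le> upper_density {n. (T ^^ n) x \<in> V}"
      using x[OF V(1)] by (intro upper_density_geI) (auto simp: G_def)
    also have "\<dots> \<le> upper_density {n. (T ^^ n) x \<in> U}"
      using V(2) by (intro upper_density_mono) auto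
    finally show "upper_density {n. (T ^^ n) x \<in> U} > 0" .
  qed
qed

lemma F_space_completely_metrizable:
  fixes sm :: "'k::real_normed_field \<Rightarrow> 'x::topological_ab_group_add \<Rightarrow> 'x"
  assumes "F_space sm"
  shows "completely_metrizable_space (euclidean :: 'x topology)"
proof -
  have V: "vector_space sm"
    using assms by (simp add: F_space_def topological_vector_space_def)
  obtain N where N: "F_norm_defines_topology sm N"
    and complete: "Metric_space.mcomplete UNIV (\<lambda>x y. N (x - y))"
    using assms by (auto simp: F_space_def)
  interpret Metric_space UNIV "\<lambda>x y. N (x - y)"
    using F_norm_Metric_space[OF V] N by (simp add: F_norm_defines_topology_def)
  show ?thesis
    using completely_metrizable_space_mtopology[OF complete] N
    by (simp add: F_norm_defines_topology_def)
qed

lemma dense_intersects_open_set: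
  assumes "closure D = UNIV" "open U" "U \<noteq> {}"
  shows "\<exists>x\<in>D. x \<in> U"
  using open_Int_closure_eq_empty[OF assms(2), of D] assms(1,3) by auto

theorem corollary24:
  fixes sm :: "'k::real_normed_field \<Rightarrow> 'x::topological_ab_group_add \<Rightarrow> 'x"
    and N :: "'x \<Rightarrow> real"
    and T :: "'x \<Rightarrow> 'x"
    and X\<^sub>0 Y\<^sub>0 :: "'x set"
    and S :: "nat \<Rightarrow> 'x \<Rightarrow> 'x"
  assumes "F_space sm"
    and "separable_space (euclidean :: 'x topology)"
    and "F_norm_defines_topology sm N"
    and "Vector_Spaces.linear sm sm T"
    and "continuous_on UNIV T"
    and "closure X\<^sub>0 = UNIV"
    and "closure Y\<^sub>0 = UNIV"
    and "\<And>y \<epsilon>. y \<in> Y\<^sub>0 \<Longrightarrow> \<epsilon> > 0 \<Longrightarrow>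
      \<exists>A (\<delta>::real). upper_density A > 0 \<and> \<delta> > 0 \<and>
        (\<forall>x\<in>X\<^sub>0. \<exists>B\<subseteq>A. upper_density B > ereal \<delta> \<and> (\<forall>n\<in>B. N ((T ^^ n) x) < \<epsilon>)) \<and>
        summable (restrict_to A (\<lambda>n. S n y)) \<and>
        (\<forall>m\<in>A. N ((T ^^ m) (suminf (restrict_to A (\<lambda>n. S n y))) - y) < \<epsilon>)"
  shows "upper_frequently_hypercyclic T"
proof -
  have N: "F_norm sm N" and top: "Metric_space.mtopology UNIV (\<lambda>x y. N (x - y)) = euclidean"
    using assms(3) by (auto simp: F_norm_defines_topology_def)
  have "vector_space sm"
    using assms(1) by (simp add: F_space_def topological_vector_space_def)
  then interpret Metric_space UNIV "\<lambda>x y. N (x - y)"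
    using N by (rule F_norm_Metric_space)
  have T_add: "(T ^^ n) (x + z) = (T ^^ n) x + (T ^^ n) z" for n x z
    by (induction n) (simp_all add: Vector_Spaces.linear.axioms(3) module_hom.add
        Vector_Spaces.linear_iff[THEN iffD1, OF assms(4)])
  show ?thesis
  proof (rule upper_frequently_hypercyclic_if_uniform_rate)
    show "completely_metrizable_space (euclidean :: 'x topology)"
      using assms(1) by (rule F_space_completely_metrizable)
    show "second_countable (euclidean :: 'x topology)"
      using separable_imp_second_countable assms(2) by (simp add: top)
    show "continuous_on UNIV T" by fact
  next
    fix V :: "'x set" assume V: "open V" "V \<noteq> {}"
    obtain y where y: "y \<in> Y\<^sub>0" "y \<in> V"
      using dense_intersects_open_set[OF assms(7) V] by blast
    have "openin mtopology V"
      using V(1) by (simp add: top)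
    then obtain r where r: "r > 0" "mball y r \<subseteq> V"
      using y(2) unfolding openin_mtopology by blast
    obtain A \<delta> where \<delta>: "\<delta> > 0"
      and B: "\<And>x. x \<in> X\<^sub>0 \<Longrightarrow>
          \<exists>B\<subseteq>A. upper_density B > ereal \<delta> \<and> (\<forall>n\<in>B. N ((T ^^ n) x) < r / 2)"
      and A: "\<And>m. m \<in> A \<Longrightarrow>
          N ((T ^^ m) (suminf (restrict_to A (\<lambda>n. S n y))) - y) < r / 2"
      using assms(8)[OF y(1) half_gt_zero[OF r(1)]] by blast
    define z where "z = suminf (restrict_to A (\<lambda>n. S n y))"
    show "\<exists>\<delta>>0. \<forall>U. open U \<and> U \<noteq> {} \<longrightarrow>
        (\<exists>x\<in>U. upper_density {n. (T ^^ n) x \<in> V} > ereal \<delta>)"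
    proof (intro exI[of _ \<delta>] conjI allI impI \<delta>, elim conjE)
      fix U :: "'x set" assume U: "open U" "U \<noteq> {}"
      have "open ((\<lambda>x. x + z) -` U)"
        by (intro open_vimage U continuous_intros)
      moreover have "(\<lambda>x. x + z) -` U \<noteq> {}"
      proof -
        obtain u where "u \<in> U" using U(2) by blast
        then have "u - z \<in> (\<lambda>x. x + z) -` U" by simp
        then show ?thesis by blast
      qed
      ultimately obtain x where x: "x \<in> X\<^sub>0" "x + z \<in> U"
        using dense_intersects_open_set[OF assms(6)] by blast
      obtain B where B: "B \<subseteq> A" "upper_density B > ereal \<delta>" "\<And>n. n \<in> B \<Longrightarrow> N ((T ^^ n) x) < r / 2"
        using B[OF x(1)] by blast
      have "(T ^^ n) (x + z) \<in> V" if n: "n \<in> B" for n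
      proof -
        have "N ((T ^^ n) (x + z) - y) = N ((T ^^ n) x + ((T ^^ n) z - y))"
          by (simp add: T_add add_diff_eq)
        also have "\<dots> \<le> N ((T ^^ n) x) + N ((T ^^ n) z - y)"
          using N by (simp add: F_norm_def)
        also have "\<dots> < r"
          using B(3)[OF n] A[of n] B(1) n by (force simp: z_def)
        finally show ?thesis
          using r(2) commute[of y] by auto
      qed
      then have "upper_density B \<le> upper_density {n. (T ^^ n) (x + z) \<in> V}"
        by (intro upper_density_mono) auto
      with x(2) B(2) show "\<exists>x\<in>U. upper_density {n. (T ^^ n) x \<in> V} > ereal \<delta>"
        by (intro bexI[of _ "x + z"]) auto
    qed
  qed
qed

end
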